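(* Let $\mathcal{P}\subseteq 2^\omega$ be a special $\Pi^0_1$ class and let $\{A_i\}_{i\in\omega}$ be a sequence of sets in $\mathcal{P}$. Then $\mathcal{P}$ has a member that is not computable by the infinite join $\bigoplus\{A_i\}_{i\in\omega}$; that is, there is $X\in\mathcal{P}$ with $X\not\leq_T\bigoplus\{A_i\}_{i\in\omega}$.
   Context: $\omega$ is the set of natural numbers; $2^{<\omega}$ is the set of finite binary strings; a set $A\subseteq\omega$ is identified with its characteristic function, an element of Cantor space $2^\omega$. $\leq_T$ is Turing reducibility. A set $\Lambda\subseteq 2^{<\omega}$ is downward closed if whenever $\sigma\in\Lambda$ and $\tau$ is an initial segment of $\sigma$, then $\tau\in\Lambda$. $[\Lambda]$ denotes the set of infinite paths through $\Lambda$, i.e. all $A\in 2^\omega$ every initial segment of which is in $\Lambda$. A class $\mathcal{P}\subseteq 2^\omega$ is a $\Pi^0_1$ class if $\mathcal{P}=[\Lambda]$ for some computable downward closed set of strings $\Lambda$. A $\Pi^0_1$ class is special if it does not contain a computable member. Let $\langle i,j\rangle$ be a fixed computable bijection $\omega\times\omega\to\omega$. For a countable sequence of sets $\{A_i\}_{i\in\omega}$, the infinite join is $\bigoplus\{A_i\}_{i\in\omega}=\{\langle i,x\rangle : x\in A_i\}$. *)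

theory Defs
  imports Main "HOL-Library.Sublist" "HOL-Library.Nat_Bijection"
begin

section \<open>Relative computability\<close>

text \<open>
  Kleene's partial recursive functions relative to a set \<open>B\<close>: \<open>computes B p xs y\<close> says that
  program \<open>p\<close> querying \<open>B\<close> halts on the argument tuple \<open>xs\<close> with output \<open>y\<close>.  Arities are not
  recorded in the syntax: one program may act on tuples of several lengths (as \<open>Zero\<close> and
  \<open>Proj i\<close> do), and it diverges on tuples of an unsuitable length.
\<close>

datatype prog =
    Zero
  | Succ
  | Proj nat
  | Query
  | Comp prog "prog list"
  | PrimRec prog prog
  | Mu prog

inductive computes :: "nat set \<Rightarrow> prog \<Rightarrow> nat list \<Rightarrow> nat \<Rightarrow> bool" for B :: "nat set" where
  zero: "computes B Zero xs 0"
| succ: "computes B Succ [x] (Suc x)"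
| proj: "i < length xs \<Longrightarrow> computes B (Proj i) xs (xs ! i)"
| query: "computes B Query [x] (if x \<in> B then 1 else 0)"
| comp: "list_all2 (\<lambda>g y. computes B g xs y) gs ys \<Longrightarrow> computes B f ys z \<Longrightarrow> computes B (Comp f gs) xs z"
| prim_rec_0: "computes B f xs y \<Longrightarrow> computes B (PrimRec f g) (0 # xs) y"
| prim_rec_Suc: "computes B (PrimRec f g) (n # xs) y \<Longrightarrow> computes B g (n # y # xs) z \<Longrightarrow>
    computes B (PrimRec f g) (Suc n # xs) z"
| mu: "computes B f (n # xs) 0 \<Longrightarrow> (\<forall>m<n. \<exists>y. computes B f (m # xs) (Suc y)) \<Longrightarrow> computes B (Mu f) xs n"

inductive_cases computes_elims:
  "computes B Zero xs y"
  "computes B Succ xs y"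
  "computes B (Proj i) xs y"
  "computes B Query xs y"
  "computes B (Comp f gs) xs y"
  "computes B (PrimRec f g) (0 # xs) y"
  "computes B (PrimRec f g) (Suc n # xs) y"
  "computes B (Mu f) xs y"

lemma computes_deterministic:
  assumes "computes B p xs y" "computes B p xs y'"
  shows "y = y'"
  using assms
proof (induction arbitrary: y' rule: computes.induct)
  case (zero xs)
  then show ?case by (rule computes_elims(1)) simp
next
  case (succ x)
  then show ?case by (rule computes_elims(2)) simp
next
  case (proj i xs)
  from proj.prems show ?case by (rule computes_elims(3)) simp
next
  case (query x)
  then show ?case by (rule computes_elims(4)) simp
next
  case (comp xs gs ys f z)
  from comp.prems obtain ys' where
    ys': "list_all2 (\<lambda>g y. computes B g xs y) gs ys'" "computes B f ys' y'"
    by (rule computes_elims(5))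
  have "length ys = length ys'"
    using comp.IH(1) ys'(1) by (simp add: list_all2_conv_all_nth)
  moreover have "ys ! i = ys' ! i" if "i < length ys" for i
    using comp.IH(1) ys'(1) that by (simp add: list_all2_conv_all_nth)
  ultimately have "ys = ys'" by (rule nth_equalityI)
  with ys'(2) comp.IH(2) show ?case by blast
next
  case (prim_rec_0 f xs y g)
  from prim_rec_0.prems have "computes B f xs y'" by (rule computes_elims(6))
  then show ?case by (rule prim_rec_0.IH)
next
  case (prim_rec_Suc f g n xs y z)
  from prim_rec_Suc.prems obtain w where
    w: "computes B (PrimRec f g) (n # xs) w" "computes B g (n # w # xs) y'"
    by (rule computes_elims(7))
  from prim_rec_Suc.IH(1)[OF w(1)] w(2) prim_rec_Suc.IH(2) show ?case by simp
next
  case (mu f n xs)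
  from mu.prems have
    n': "computes B f (y' # xs) 0" "\<forall>m<y'. \<exists>y. computes B f (m # xs) (Suc y)"
    by (rule computes_elims(8), simp)+
  have "\<not> n < y'" using mu.IH(1) n'(2) by (metis nat.distinct(1))
  moreover have "\<not> y' < n" using mu.IH(2) n'(1) by (metis nat.distinct(1))
  ultimately show ?case by simp
qed

definition turing_le :: "nat set \<Rightarrow> nat set \<Rightarrow> bool" (infix "\<le>\<^sub>T" 50) where
  "A \<le>\<^sub>T B \<longleftrightarrow> (\<exists>p. \<forall>x. computes B p [x] (if x \<in> A then 1 else 0))"

text \<open>Over the empty set, \<open>Query\<close> is the constant function 0 and so adds nothing to the
  partial recursive functions.\<close>

definition computable :: "nat set \<Rightarrow> bool" where
  "computable A \<longleftrightarrow> A \<le>\<^sub>T {}"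

section \<open>Strings and \<open>\<Pi>\<^sup>0\<^sub>1\<close> classes\<close>

text \<open>The computable bijection from binary strings to \<open>\<nat>\<close> under which the binary expansion of
  \<open>string_code \<sigma> + 1\<close> is a leading 1 followed by the reversal of \<open>\<sigma>\<close>.\<close>

primrec string_code :: "bool list \<Rightarrow> nat" where
  "string_code [] = 0"
| "string_code (b # \<sigma>) = 2 * string_code \<sigma> + (if b then 2 else 1)"

definition computable_strings :: "bool list set \<Rightarrow> bool" where
  "computable_strings \<Lambda> \<longleftrightarrow> computable (string_code ` \<Lambda>)"

definition downward_closed :: "bool list set \<Rightarrow> bool" where
  "downward_closed \<Lambda> \<longleftrightarrow> (\<forall>\<sigma> \<tau>. \<sigma> \<in> \<Lambda> \<longrightarrow> prefix \<tau> \<sigma> \<longrightarrow> \<tau> \<in> \<Lambda>)"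

text \<open>Points of Cantor space are represented by sets of naturals; \<open>initial_segment A n\<close> lists the
  first \<open>n\<close> values of the characteristic function of \<open>A\<close>.\<close>

definition initial_segment :: "nat set \<Rightarrow> nat \<Rightarrow> bool list" where
  "initial_segment A n = map (\<lambda>i. i \<in> A) [0..<n]"

definition paths :: "bool list set \<Rightarrow> nat set set" where
  "paths \<Lambda> = {A. \<forall>n. initial_segment A n \<in> \<Lambda>}"

definition Pi01_class :: "nat set set \<Rightarrow> bool" where
  "Pi01_class P \<longleftrightarrow> (\<exists>\<Lambda>. computable_strings \<Lambda> \<and> downward_closed \<Lambda> \<and> P = paths \<Lambda>)"

definition special_Pi01_class :: "nat set set \<Rightarrow> bool" where
  "special_Pi01_class P \<longleftrightarrow> Pi01_class P \<and> \<not> (\<exists>X\<in>P. computable X)"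

definition infinite_join :: "(nat \<Rightarrow> nat set) \<Rightarrow> nat set" where
  "infinite_join A = {prod_encode (i, x) | i x. x \<in> A i}"

end

theory Submission
  imports Defs "HOL-Library.Countable"
begin

text \<open>
  Only countably many sets are computable from a given set \<open>B\<close>, since there are countably many
  programs (\<open>turing_below_enumeration\<close>).  It therefore suffices that a nonempty special
  \<open>\<Pi>\<^sup>0\<^sub>1\<close> class \<open>P\<close> is uncountable.

  An isolated member \<open>X\<close> of a \<open>\<Pi>\<^sup>0\<^sub>1\<close> class is computable (\<open>isolated_path_computable\<close>):
  if \<open>X\<close> is the only path of the computable tree \<open>\<Lambda>\<close> that agrees with \<open>X\<close> below \<open>k\<close>, then, by
  Koenig's lemma, for every \<open>n\<close> there is a level \<open>L\<close> at which all strings in \<open>\<Lambda>\<close> that agree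
  with \<open>X\<close> below \<open>k\<close> have the same bit at position \<open>n\<close>, and this bit is \<open>X(n)\<close>.  Such an \<open>L\<close>
  can be found by an unbounded search, each step of which inspects finitely many strings.

  Hence a special class has no isolated members, and the usual diagonal construction
  (\<open>diagonal_path\<close>) yields, for any sequence of sets, a member of \<open>P\<close> outside the sequence.
\<close>

section \<open>Closure properties of the recursive functions\<close>

text \<open>The function \<open>f\<close>, restricted to tuples of length \<open>k\<close>, is total recursive in \<open>B\<close>; its values
  on tuples of other lengths are irrelevant.\<close>

definition recursive_fun :: "nat set \<Rightarrow> nat \<Rightarrow> (nat list \<Rightarrow> nat) \<Rightarrow> bool" where
  "recursive_fun B k f \<longleftrightarrow> (\<exists>p. \<forall>xs. length xs = k \<longrightarrow> computes B p xs (f xs))"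

text \<open>The predicate \<open>Q\<close>, restricted to tuples of length \<open>k\<close>, is decidable relative to \<open>B\<close>.\<close>

definition recursive_pred :: "nat set \<Rightarrow> nat \<Rightarrow> (nat list \<Rightarrow> bool) \<Rightarrow> bool" where
  "recursive_pred B k Q \<longleftrightarrow> recursive_fun B k (\<lambda>xs. of_bool (Q xs))"

lemma recursive_fun_cong:
  assumes "\<And>xs. length xs = k \<Longrightarrow> f xs = g xs"
  shows "recursive_fun B k f \<longleftrightarrow> recursive_fun B k g"
  using assms by (auto simp: recursive_fun_def)

lemma recursive_pred_cong:
  assumes "\<And>xs. length xs = k \<Longrightarrow> Q xs \<longleftrightarrow> R xs"
  shows "recursive_pred B k Q \<longleftrightarrow> recursive_pred B k R"
  unfolding recursive_pred_def using assms by (intro recursive_fun_cong) auto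

lemma recursive_fun_nth: "i < k \<Longrightarrow> recursive_fun B k (\<lambda>xs. xs ! i)"
  unfolding recursive_fun_def by (intro exI[of _ "Proj i"]) (auto intro: computes.proj)

lemma recursive_fun_comp:
  assumes "recursive_fun B (length gs) f" "\<And>g. g \<in> set gs \<Longrightarrow> recursive_fun B k g"
  shows "recursive_fun B k (\<lambda>xs. f (map (\<lambda>g. g xs) gs))"
proof -
  obtain p where p: "\<And>xs. length xs = length gs \<Longrightarrow> computes B p xs (f xs)"
    using assms(1) by (auto simp: recursive_fun_def)
  have "\<forall>g\<in>set gs. \<exists>q. \<forall>xs. length xs = k \<longrightarrow> computes B q xs (g xs)"
    using assms(2) by (auto simp: recursive_fun_def)
  then obtain q where q: "\<And>g xs. g \<in> set gs \<Longrightarrow> length xs = k \<Longrightarrow> computes B (q g) xs (g xs)"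
    by metis
  have "computes B (Comp p (map q gs)) xs (f (map (\<lambda>g. g xs) gs))" if "length xs = k" for xs
  proof (rule computes.comp)
    show "list_all2 (\<lambda>g y. computes B g xs y) (map q gs) (map (\<lambda>g. g xs) gs)"
      using q that by (simp add: list_all2_conv_all_nth)
    show "computes B p (map (\<lambda>g. g xs) gs) (f (map (\<lambda>g. g xs) gs))"
      by (rule p) simp
  qed
  then show ?thesis unfolding recursive_fun_def by blast
qed

lemma recursive_fun_Suc:
  assumes "recursive_fun B k f"
  shows "recursive_fun B k (\<lambda>xs. Suc (f xs))"
proof -
  have "computes B Succ xs (Suc (xs ! 0))" if "length xs = 1" for xs
    using that computes.succ by (cases xs) auto
  then have "recursive_fun B (length [f]) (\<lambda>xs. Suc (xs ! 0))"
    unfolding recursive_fun_def by auto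
  from recursive_fun_comp[OF this, of k] assms show ?thesis by simp
qed

lemma recursive_fun_const: "recursive_fun B k (\<lambda>_. c)"
proof (induction c)
  case 0
  show ?case unfolding recursive_fun_def by (intro exI[of _ Zero]) (simp add: computes.zero)
next
  case (Suc c)
  then show ?case by (rule recursive_fun_Suc)
qed

lemma map_nth_shift: "length xs = j + k \<Longrightarrow> map (\<lambda>i. xs ! (i + j)) [0..<k] = drop j xs"
  by (intro nth_equalityI) (auto simp: add.commute)

text \<open>Primitive recursion on the value of a recursive function \<open>b\<close>, all arguments serving as
  parameters.\<close>

lemma recursive_fun_rec_nat:
  assumes f: "recursive_fun B k f" and g: "recursive_fun B (Suc (Suc k)) g"
    and b: "recursive_fun B k b"
  shows "recursive_fun B k (\<lambda>xs. rec_nat (f xs) (\<lambda>n y. g (n # y # xs)) (b xs))"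
proof -
  let ?R = "\<lambda>n xs. rec_nat (f xs) (\<lambda>n y. g (n # y # xs)) n"
  obtain p q where p: "\<And>xs. length xs = k \<Longrightarrow> computes B p xs (f xs)"
    and q: "\<And>xs. length xs = Suc (Suc k) \<Longrightarrow> computes B q xs (g xs)"
    using f g by (auto simp: recursive_fun_def)
  have "computes B (PrimRec p q) (n # xs) (?R n xs)" if "length xs = k" for n xs
  proof (induction n)
    case 0
    show ?case using p that by (auto intro: computes.prim_rec_0)
  next
    case (Suc n)
    show ?case using computes.prim_rec_Suc[OF Suc q] that by simp
  qed
  then have "computes B (PrimRec p q) zs (?R (hd zs) (tl zs))" if "length zs = Suc k" for zs
    using that by (cases zs) auto
  then have R: "recursive_fun B (Suc k) (\<lambda>zs. ?R (hd zs) (tl zs))"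
    unfolding recursive_fun_def by blast
  let ?gs = "b # map (\<lambda>i xs. xs ! i) [0..<k]"
  have "recursive_fun B k (\<lambda>xs. ?R (hd (map (\<lambda>g. g xs) ?gs)) (tl (map (\<lambda>g. g xs) ?gs)))"
    by (rule recursive_fun_comp[where gs = ?gs and f = "\<lambda>zs. ?R (hd zs) (tl zs)"])
      (use R b in \<open>auto intro: recursive_fun_nth\<close>)
  moreover have "map (\<lambda>g. g xs) (map (\<lambda>i xs. xs ! i) [0..<k]) = xs" if "length xs = k"
    for xs :: "nat list"
    using that map_nth[of xs] by (simp add: comp_def)
  ultimately show ?thesis
    by (subst recursive_fun_cong) auto
qed

lemma recursive_fun_Cons_drop2:
  assumes "recursive_fun B (Suc k) f"
  shows "recursive_fun B (Suc (Suc k)) (\<lambda>zs. f (zs ! 0 # drop 2 zs))"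
proof -
  let ?gs = "(\<lambda>zs. zs ! 0) # map (\<lambda>i zs. zs ! (i + 2)) [0..<k]"
  have "recursive_fun B (Suc (Suc k)) (\<lambda>zs. f (map (\<lambda>g. g zs) ?gs))"
    by (rule recursive_fun_comp) (use assms in \<open>auto intro!: recursive_fun_nth\<close>)
  moreover have "map (\<lambda>g. g zs) ?gs = zs ! 0 # drop 2 zs" if "length zs = Suc (Suc k)"
    for zs :: "nat list"
    using map_nth_shift[of zs 2 k] that by (simp add: comp_def)
  ultimately show ?thesis
    by (subst recursive_fun_cong) auto
qed

lemma recursive_fun_drop2:
  assumes "recursive_fun B k f"
  shows "recursive_fun B (Suc (Suc k)) (\<lambda>zs. f (drop 2 zs))"
proof -
  let ?gs = "map (\<lambda>i zs. zs ! (i + 2)) [0..<k]"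
  have "recursive_fun B (Suc (Suc k)) (\<lambda>zs. f (map (\<lambda>g. g zs) ?gs))"
    by (rule recursive_fun_comp) (use assms in \<open>auto intro!: recursive_fun_nth\<close>)
  moreover have "map (\<lambda>g. g zs) ?gs = drop 2 zs" if "length zs = Suc (Suc k)"
    for zs :: "nat list"
    using map_nth_shift[of zs 2 k] that by (simp add: comp_def)
  ultimately show ?thesis
    by (subst recursive_fun_cong) auto
qed

lemma recursive_pred_neq_0:
  assumes "recursive_fun B k f"
  shows "recursive_pred B k (\<lambda>xs. f xs \<noteq> 0)"
proof -
  have "rec_nat 0 (\<lambda>_ _. 1) n = (of_bool (n \<noteq> 0) :: nat)" for n :: nat
    by (cases n) auto
  with recursive_fun_rec_nat[OF recursive_fun_const[where c = 0] recursive_fun_const[where c = 1] assms]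
  show ?thesis by (simp add: recursive_pred_def)
qed

lemma recursive_pred_Not:
  assumes "recursive_pred B k Q"
  shows "recursive_pred B k (\<lambda>xs. \<not> Q xs)"
proof -
  have "rec_nat 1 (\<lambda>_ _. 0) (of_bool b) = (of_bool (\<not> b) :: nat)" for b
    by (cases b) auto
  with recursive_fun_rec_nat[OF recursive_fun_const[where c = 1] recursive_fun_const[where c = 0]
      assms[unfolded recursive_pred_def]]
  show ?thesis by (simp add: recursive_pred_def)
qed

lemma recursive_pred_conj:
  assumes "recursive_pred B k Q" "recursive_pred B k R"
  shows "recursive_pred B k (\<lambda>xs. Q xs \<and> R xs)"
proof -
  have "rec_nat 0 (\<lambda>_ _. of_bool c) (of_bool b) = (of_bool (b \<and> c) :: nat)" for b c
    by (cases b) auto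
  with recursive_fun_rec_nat[OF recursive_fun_const[where c = 0]
      recursive_fun_drop2[OF assms(2)[unfolded recursive_pred_def]]
      assms(1)[unfolded recursive_pred_def]]
  show ?thesis by (simp add: recursive_pred_def)
qed

lemma recursive_pred_imp:
  assumes "recursive_pred B k Q" "recursive_pred B k R"
  shows "recursive_pred B k (\<lambda>xs. Q xs \<longrightarrow> R xs)"
  using recursive_pred_Not[OF recursive_pred_conj[OF assms(1) recursive_pred_Not[OF assms(2)]]]
  by simp

lemma recursive_pred_disj:
  assumes "recursive_pred B k Q" "recursive_pred B k R"
  shows "recursive_pred B k (\<lambda>xs. Q xs \<or> R xs)"
  using recursive_pred_imp[OF recursive_pred_Not[OF assms(1)] assms(2)] by (simp add: disj_imp)

lemma recursive_pred_iff:
  assumes "recursive_pred B k Q" "recursive_pred B k R"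
  shows "recursive_pred B k (\<lambda>xs. Q xs \<longleftrightarrow> R xs)"
  using recursive_pred_conj[OF recursive_pred_imp[OF assms] recursive_pred_imp[OF assms(2,1)]]
  by (simp add: iff_conv_conj_imp)

lemma recursive_pred_bounded_all:
  assumes Q: "recursive_pred B (Suc k) Q" and b: "recursive_fun B k b"
  shows "recursive_pred B k (\<lambda>xs. \<forall>c<b xs. Q (c # xs))"
proof -
  \<comment> \<open>The recursion on the bound has the step \<open>zs = n # y # xs\<close>, where \<open>y\<close> is the truth value for
    the numbers below \<open>n\<close>.\<close>
  have "recursive_pred B (Suc (Suc k)) (\<lambda>zs. zs ! 1 \<noteq> 0 \<and> Q (zs ! 0 # drop 2 zs))"
    using recursive_fun_Cons_drop2[OF Q[unfolded recursive_pred_def]]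
    by (intro recursive_pred_conj recursive_pred_neq_0 recursive_fun_nth)
      (auto simp: recursive_pred_def)
  from recursive_fun_rec_nat[OF recursive_fun_const[where c = 1] this[unfolded recursive_pred_def] b]
  have "recursive_fun B k (\<lambda>xs. rec_nat 1 (\<lambda>n y. of_bool (y \<noteq> 0 \<and> Q (n # xs))) (b xs))"
    by simp
  moreover have "rec_nat 1 (\<lambda>n y. of_bool (y \<noteq> 0 \<and> Q (n # xs))) m
    = (of_bool (\<forall>c<m. Q (c # xs)) :: nat)" for m xs
    by (induction m) (auto simp: less_Suc_eq)
  ultimately show ?thesis by (simp add: recursive_pred_def)
qed

lemma recursive_fun_Least:
  assumes Q: "recursive_pred B (Suc k) Q"
    and ex: "\<And>xs. length xs = k \<Longrightarrow> \<exists>n. Q (n # xs)"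
  shows "recursive_fun B k (\<lambda>xs. LEAST n. Q (n # xs))"
proof -
  obtain p where p: "\<And>zs. length zs = Suc k \<Longrightarrow> computes B p zs (of_bool (\<not> Q zs))"
    using recursive_pred_Not[OF Q] by (auto simp: recursive_pred_def recursive_fun_def)
  have "computes B (Mu p) xs (LEAST n. Q (n # xs))" if len: "length xs = k" for xs
  proof (rule computes.mu)
    have "Q ((LEAST n. Q (n # xs)) # xs)"
      using ex[OF len] by (rule LeastI_ex)
    with p[of "(LEAST n. Q (n # xs)) # xs"] len
    show "computes B p ((LEAST n. Q (n # xs)) # xs) 0" by simp
    show "\<forall>m<(LEAST n. Q (n # xs)). \<exists>y. computes B p (m # xs) (Suc y)"
    proof (intro allI impI)
      fix m assume "m < (LEAST n. Q (n # xs))"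
      then have "\<not> Q (m # xs)" by (rule not_less_Least)
      with p[of "m # xs"] len show "\<exists>y. computes B p (m # xs) (Suc y)" by auto
    qed
  qed
  then show ?thesis unfolding recursive_fun_def by blast
qed

lemma recursive_fun_add:
  assumes "recursive_fun B k f" "recursive_fun B k g"
  shows "recursive_fun B k (\<lambda>xs. f xs + g xs)"
proof -
  have "rec_nat m (\<lambda>_ y. Suc y) n = m + n" for m n by (induction n) auto
  with recursive_fun_rec_nat[OF assms(1)
      recursive_fun_Suc[OF recursive_fun_nth[where i = 1]] assms(2)]
  show ?thesis by simp
qed

lemma recursive_fun_pred:
  assumes "recursive_fun B k f"
  shows "recursive_fun B k (\<lambda>xs. f xs - 1)"
proof -
  have "rec_nat 0 (\<lambda>n _. n) n = n - 1" for n by (cases n) auto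
  with recursive_fun_rec_nat[OF recursive_fun_const[where c = 0]
      recursive_fun_nth[where i = 0] assms]
  show ?thesis by simp
qed

lemma recursive_fun_power2:
  assumes "recursive_fun B k f"
  shows "recursive_fun B k (\<lambda>xs. 2 ^ f xs)"
proof -
  have "rec_nat 1 (\<lambda>_ y. y + y) n = (2 ^ n :: nat)" for n by (induction n) auto
  with recursive_fun_rec_nat[OF recursive_fun_const[where c = 1]
      recursive_fun_add[OF recursive_fun_nth[where i = 1] recursive_fun_nth[where i = 1]] assms]
  show ?thesis by simp
qed

lemma recursive_pred_odd:
  assumes "recursive_fun B k f"
  shows "recursive_pred B k (\<lambda>xs. odd (f xs))"
proof -
  have "rec_nat 0 (\<lambda>_ y. of_bool (\<not> y \<noteq> 0)) n = (of_bool (odd n) :: nat)" for n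
    by (induction n) auto
  with recursive_fun_rec_nat[OF recursive_fun_const[where c = 0]
      recursive_pred_Not[OF recursive_pred_neq_0[OF recursive_fun_nth[where i = 1]],
        unfolded recursive_pred_def] assms]
  show ?thesis by (simp add: recursive_pred_def)
qed

lemma recursive_fun_half:
  assumes "recursive_fun B k f"
  shows "recursive_fun B k (\<lambda>xs. f xs div 2)"
proof -
  have "rec_nat 0 (\<lambda>n y. y + of_bool (odd n)) n = n div 2" for n :: nat
    by (induction n) (auto elim!: evenE oddE)
  with recursive_fun_rec_nat[OF recursive_fun_const[where c = 0]
      recursive_fun_add[OF recursive_fun_nth[where i = 1]
        recursive_pred_odd[OF recursive_fun_nth[where i = 0], unfolded recursive_pred_def]] assms]
  show ?thesis by simp
qed

lemma recursive_fun_div_power2: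
  assumes "recursive_fun B k f" "recursive_fun B k g"
  shows "recursive_fun B k (\<lambda>xs. f xs div 2 ^ g xs)"
proof -
  have "rec_nat m (\<lambda>_ y. y div 2) n = m div 2 ^ n" for m n :: nat
    by (induction n) (auto simp: div_mult2_eq[symmetric] mult.commute)
  with recursive_fun_rec_nat[OF assms(1)
      recursive_fun_half[OF recursive_fun_nth[where i = 1]] assms(2)]
  show ?thesis by simp
qed

lemma turing_le_iff_recursive_pred: "X \<le>\<^sub>T B \<longleftrightarrow> recursive_pred B 1 (\<lambda>xs. xs ! 0 \<in> X)"
proof -
  have "(\<forall>xs. length xs = 1 \<longrightarrow> computes B p xs (of_bool (xs ! 0 \<in> X)))
    \<longleftrightarrow> (\<forall>x. computes B p [x] (of_bool (x \<in> X)))"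
    (is "?L \<longleftrightarrow> ?R") for p
  proof
    assume ?L
    then show ?R by (metis length_Cons list.size(3) nth_Cons_0 One_nat_def)
  next
    assume R: ?R
    show ?L
    proof (intro allI impI)
      fix xs :: "nat list" assume "length xs = 1"
      then obtain x where "xs = [x]" by (auto simp: length_Suc_conv)
      with R show "computes B p xs (of_bool (xs ! 0 \<in> X))" by simp
    qed
  qed
  then show ?thesis
    by (simp add: turing_le_def recursive_pred_def recursive_fun_def of_bool_def)
qed

lemma recursive_pred_mem:
  assumes "X \<le>\<^sub>T B" "recursive_fun B k f"
  shows "recursive_pred B k (\<lambda>xs. f xs \<in> X)"
  using recursive_fun_comp[of B "[f]" "\<lambda>xs. of_bool (xs ! 0 \<in> X)" k] assms
  by (simp add: turing_le_iff_recursive_pred recursive_pred_def)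

text \<open>One direction of Post's theorem: a set is recursive in \<open>B\<close> if it and its complement are recursively
  enumerable in \<open>B\<close>.  Here \<open>n \<in> X\<close> is witnessed by an \<open>m\<close> with \<open>Q [m, n]\<close>, and \<open>n \<notin> X\<close> by an
  \<open>m\<close> with \<open>R [m, n]\<close>.\<close>

lemma turing_le_if_both_enumerable:
  assumes Q: "recursive_pred B 2 Q" and R: "recursive_pred B 2 R"
    and pos: "\<And>m n. Q [m, n] \<Longrightarrow> n \<in> X" and neg: "\<And>m n. R [m, n] \<Longrightarrow> n \<notin> X"
    and ex: "\<And>n. \<exists>m. Q [m, n] \<or> R [m, n]"
  shows "X \<le>\<^sub>T B"
proof -
  let ?M = "\<lambda>xs. LEAST m. Q (m # xs) \<or> R (m # xs)"
  have "recursive_pred B (Suc 1) (\<lambda>zs. Q zs \<or> R zs)"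
    using recursive_pred_disj[OF Q R] by (simp add: numeral_2_eq_2)
  then have "recursive_fun B 1 ?M"
    by (rule recursive_fun_Least) (use ex in \<open>auto simp: length_Suc_conv\<close>)
  then have "recursive_fun B 1 (\<lambda>xs. of_bool (Q [?M xs, xs ! 0]))"
    using recursive_fun_comp[of B "[?M, \<lambda>xs. xs ! 0]" "\<lambda>zs. of_bool (Q zs)" 1] Q
    by (auto simp: recursive_pred_def numeral_2_eq_2 intro: recursive_fun_nth)
  moreover have "Q [?M xs, xs ! 0] \<longleftrightarrow> xs ! 0 \<in> X" if "length xs = 1" for xs
  proof -
    obtain n where n: "xs = [n]" using \<open>length xs = 1\<close> by (auto simp: length_Suc_conv)
    have "Q [?M [n], n] \<or> R [?M [n], n]" using ex[of n] by (rule LeastI_ex)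
    with pos neg n show ?thesis by auto
  qed
  ultimately show ?thesis
    unfolding turing_le_iff_recursive_pred
    by (subst recursive_pred_cong[symmetric]) (auto simp: recursive_pred_def)
qed

section \<open>Codes of strings\<close>

lemma string_code_lower: "2 ^ length \<sigma> \<le> Suc (string_code \<sigma>)"
  by (induction \<sigma>) auto

lemma string_code_upper: "Suc (string_code \<sigma>) < 2 ^ Suc (length \<sigma>)"
  by (induction \<sigma>) auto

lemma string_code_length:
  assumes "Suc (string_code \<sigma>) = 2 ^ L + j" "j < 2 ^ L"
  shows "length \<sigma> = L"
proof (rule ccontr)
  assume "length \<sigma> \<noteq> L"
  then consider "Suc (length \<sigma>) \<le> L" | "Suc L \<le> length \<sigma>" by linarith
  then show False
  proof cases
    case 1
    then have "(2::nat) ^ Suc (length \<sigma>) \<le> 2 ^ L" by (intro power_increasing) auto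
    then show False using string_code_upper[of \<sigma>] assms(1) by linarith
  next
    case 2
    then have "(2::nat) ^ Suc L \<le> 2 ^ length \<sigma>" by (intro power_increasing) auto
    then show False using string_code_lower[of \<sigma>] assms by simp
  qed
qed

lemma string_code_bit:
  "i < length \<sigma> \<Longrightarrow> odd (Suc (string_code \<sigma>) div 2 ^ i) \<longleftrightarrow> \<sigma> ! i"
proof (induction \<sigma> arbitrary: i)
  case (Cons b \<sigma>)
  show ?case
  proof (cases i)
    case (Suc i')
    have "Suc (string_code (b # \<sigma>)) div 2 = Suc (string_code \<sigma>)" by auto
    then have "Suc (string_code (b # \<sigma>)) div 2 ^ Suc i' = Suc (string_code \<sigma>) div 2 ^ i'"
      by (simp only: power_Suc div_mult2_eq)
    with Cons Suc show ?thesis by simp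
  qed simp
qed simp

lemma length_initial_segment [simp]: "length (initial_segment X n) = n"
  by (simp add: initial_segment_def)

lemma nth_initial_segment [simp]: "i < n \<Longrightarrow> initial_segment X n ! i \<longleftrightarrow> i \<in> X"
  by (simp add: initial_segment_def)

section \<open>Isolated paths are computable\<close>

text \<open>Koenig's lemma for binary trees.\<close>

lemma binary_tree_has_path:
  assumes closed: "downward_closed T" and long: "\<And>L. \<exists>\<rho>\<in>T. L \<le> length \<rho>"
  shows "\<exists>X. X \<in> paths T"
proof -
  define ext where "ext \<tau> \<longleftrightarrow> (\<forall>L. \<exists>\<rho>\<in>T. L \<le> length \<rho> \<and> prefix \<tau> \<rho>)" for \<tau>
  have "\<exists>f. \<forall>n. (ext (f n) \<and> length (f n) = n) \<and> (\<exists>b. f (Suc n) = f n @ [b])"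
  proof (rule dependent_nat_choice)
    show "\<exists>\<tau>. ext \<tau> \<and> length \<tau> = 0" using long by (auto simp: ext_def)
    fix \<tau> n assume \<tau>: "ext \<tau> \<and> length \<tau> = n"
    have "ext (\<tau> @ [True]) \<or> ext (\<tau> @ [False])"
    proof (rule ccontr)
      assume "\<not> (ext (\<tau> @ [True]) \<or> ext (\<tau> @ [False]))"
      then obtain L1 L2 where L:
        "\<And>\<rho>. \<rho> \<in> T \<Longrightarrow> L1 \<le> length \<rho> \<Longrightarrow> \<not> prefix (\<tau> @ [True]) \<rho>"
        "\<And>\<rho>. \<rho> \<in> T \<Longrightarrow> L2 \<le> length \<rho> \<Longrightarrow> \<not> prefix (\<tau> @ [False]) \<rho>"
        unfolding ext_def by blast
      obtain \<rho> where \<rho>: "\<rho> \<in> T" "L1 + L2 + Suc n \<le> length \<rho>" "prefix \<tau> \<rho>"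
        using \<tau> unfolding ext_def by blast
      then obtain \<eta> where \<eta>: "\<rho> = \<tau> @ \<eta>" by (auto simp: prefix_def)
      with \<rho>(2) \<tau> obtain b \<eta>' where "\<eta> = b # \<eta>'" by (cases \<eta>) auto
      then have "prefix (\<tau> @ [b]) \<rho>" using \<eta> by simp
      then show False using L \<rho>(1,2) by (cases b) auto
    qed
    then show "\<exists>\<tau>'. (ext \<tau>' \<and> length \<tau>' = Suc n) \<and> (\<exists>b. \<tau>' = \<tau> @ [b])"
      using \<tau> by auto
  qed
  then obtain f where f: "\<And>n. ext (f n)" "\<And>n. length (f n) = n"
    and step: "\<And>n. \<exists>b. f (Suc n) = f n @ [b]" by blast
  let ?X = "{i. f (Suc i) ! i}"
  have "initial_segment ?X n = f n" for n
  proof (induction n)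
    case 0
    then show ?case using f(2)[of 0] by (simp add: initial_segment_def)
  next
    case (Suc n)
    obtain b where "f (Suc n) = f n @ [b]" using step by blast
    with Suc f(2)[of n] show ?case by (simp add: initial_segment_def nth_append)
  qed
  moreover have "f n \<in> T" for n
    using f(1)[of n] closed by (auto simp: ext_def downward_closed_def)
  ultimately have "?X \<in> paths T" by (simp add: paths_def)
  then show ?thesis ..
qed

text \<open>If \<open>X\<close> is the only path that agrees with \<open>X\<close> below \<open>k\<close>, then from some level on all strings in
  the tree that agree with \<open>X\<close> below \<open>k\<close> have the bit \<open>X(n)\<close> at position \<open>n\<close>.\<close>

lemma isolated_path_bit_decided:
  assumes closed: "downward_closed \<Lambda>"
    and isolated: "\<And>Y. Y \<in> paths \<Lambda> \<Longrightarrow> (\<forall>i<k. i \<in> Y \<longleftrightarrow> i \<in> X) \<Longrightarrow> Y = X"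
  shows "\<exists>L. \<forall>\<tau>\<in>\<Lambda>. L \<le> length \<tau> \<longrightarrow> (\<forall>i<k. \<tau> ! i \<longleftrightarrow> i \<in> X) \<longrightarrow> (\<tau> ! n \<longleftrightarrow> n \<in> X)"
proof (rule ccontr)
  let ?N = "Suc (k + n)"
  let ?bad = "\<lambda>\<tau>. \<tau> \<in> \<Lambda> \<and> ?N \<le> length \<tau> \<and> (\<forall>i<k. \<tau> ! i \<longleftrightarrow> i \<in> X) \<and> (\<tau> ! n \<longleftrightarrow> n \<notin> X)"
  assume undecided: "\<not> ?thesis"
  have bad: "\<exists>\<tau>. ?bad \<tau> \<and> L \<le> length \<tau>" for L
  proof -
    obtain \<tau> where "\<tau> \<in> \<Lambda>" "L + ?N \<le> length \<tau>" "\<forall>i<k. \<tau> ! i \<longleftrightarrow> i \<in> X" "\<tau> ! n \<longleftrightarrow> n \<notin> X"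
      using undecided by blast
    then have "?bad \<tau> \<and> L \<le> length \<tau>" by simp
    then show ?thesis ..
  qed
  \<comment> \<open>The prefixes of the bad strings form an infinite subtree, a path of which contradicts
    isolation.\<close>
  define T where "T = {\<rho>. \<exists>\<tau>. ?bad \<tau> \<and> prefix \<rho> \<tau>}"
  have "downward_closed T"
    unfolding downward_closed_def T_def by (auto intro: prefix_order.trans)
  moreover have "\<exists>\<rho>\<in>T. L \<le> length \<rho>" for L
    using bad[of L] by (auto simp: T_def)
  ultimately obtain Y where Y: "Y \<in> paths T" using binary_tree_has_path by blast
  have "T \<subseteq> \<Lambda>" using closed by (auto simp: T_def downward_closed_def)
  then have "Y \<in> paths \<Lambda>" using Y by (auto simp: paths_def)
  have "initial_segment Y ?N \<in> T" using Y by (simp add: paths_def)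
  then obtain \<tau> where \<tau>: "?bad \<tau>" "prefix (initial_segment Y ?N) \<tau>" by (auto simp: T_def)
  have agree: "\<tau> ! i \<longleftrightarrow> i \<in> Y" if "i < ?N" for i
    using \<tau>(2) that by (auto simp: prefix_def nth_append simp del: upt_Suc)
  have "Y = X" using \<open>Y \<in> paths \<Lambda>\<close> \<tau>(1) agree by (intro isolated) auto
  then show False using \<tau>(1) agree[of n] by auto
qed

lemma isolated_path_computable:
  assumes comp: "computable_strings \<Lambda>" and closed: "downward_closed \<Lambda>"
    and X: "X \<in> paths \<Lambda>"
    and isolated: "\<And>Y. Y \<in> paths \<Lambda> \<Longrightarrow> (\<forall>i<k. i \<in> Y \<longleftrightarrow> i \<in> X) \<Longrightarrow> Y = X"
  shows "computable X"
proof -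
  let ?S = "string_code ` \<Lambda>"
  define v where "v = Suc (string_code (initial_segment X k))"
  have v: "odd (v div 2 ^ i) \<longleftrightarrow> i \<in> X" if "i < k" for i
    using that string_code_bit[of i "initial_segment X k"] by (simp add: v_def)
  \<comment> \<open>Strings of length \<open>L\<close> have the codes \<open>2 ^ L + j - 1\<close> with \<open>j < 2 ^ L\<close>.  The levels
    considered exceed both \<open>k\<close> and \<open>n\<close>, so that the bits looked at are those of the string and
    not the leading 1 of its code.  The candidates are the strings of length \<open>lev m n\<close> in
    \<open>\<Lambda>\<close> that agree with \<open>X\<close> below \<open>k\<close>, and \<open>D b [m, n]\<close> says that all of them have bit \<open>b\<close>
    at position \<open>n\<close>.\<close>
  define lev where "lev m n = k + n + 1 + m" for m n :: nat
  define cand where "cand j m n \<longleftrightarrow> 2 ^ lev m n + j - 1 \<in> ?S \<and>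
    (\<forall>i<k. odd ((2 ^ lev m n + j) div 2 ^ i) \<longleftrightarrow> odd (v div 2 ^ i))" for j m n
  define D where "D b xs \<longleftrightarrow> (\<forall>j<2 ^ lev (xs ! 0) (xs ! 1). cand j (xs ! 0) (xs ! 1) \<longrightarrow>
    (odd ((2 ^ lev (xs ! 0) (xs ! 1) + j) div 2 ^ (xs ! 1)) \<longleftrightarrow> b))" for b xs
  note rec_intros = recursive_pred_imp recursive_pred_iff recursive_pred_conj recursive_pred_odd
    recursive_fun_div_power2 recursive_fun_power2 recursive_fun_add recursive_fun_pred
    recursive_fun_nth recursive_fun_const
  have S: "?S \<le>\<^sub>T {}" using comp by (simp add: computable_strings_def computable_def)
  have const: "recursive_pred {} 3 (\<lambda>_. b)" for b
    unfolding recursive_pred_def by (rule recursive_fun_const)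
  have "recursive_pred {} (Suc 3) (\<lambda>zs. odd ((2 ^ lev (zs ! 2) (zs ! 3) + zs ! 1) div 2 ^ (zs ! 0))
      \<longleftrightarrow> odd (v div 2 ^ (zs ! 0)))"
    unfolding lev_def by (intro rec_intros) auto
  from recursive_pred_bounded_all[OF this recursive_fun_const[where c = k]]
  have agree: "recursive_pred {} 3 (\<lambda>zs. \<forall>i<k. odd ((2 ^ lev (zs ! 1) (zs ! 2) + zs ! 0) div 2 ^ i)
      \<longleftrightarrow> odd (v div 2 ^ i))"
    by simp
  have "recursive_pred {} 3 (\<lambda>zs. cand (zs ! 0) (zs ! 1) (zs ! 2))"
    unfolding cand_def
    by (intro recursive_pred_conj recursive_pred_mem[OF S] agree) (unfold lev_def, intro rec_intros, auto)
  then have D_step: "recursive_pred {} (Suc 2) (\<lambda>zs. cand (zs ! 0) (zs ! 1) (zs ! 2) \<longrightarrow>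
      (odd ((2 ^ lev (zs ! 1) (zs ! 2) + zs ! 0) div 2 ^ (zs ! 2)) \<longleftrightarrow> b))" for b
    unfolding lev_def Suc_numeral by (intro rec_intros) (auto intro: const)
  have "recursive_fun {} 2 (\<lambda>xs. 2 ^ lev (xs ! 0) (xs ! 1))"
    unfolding lev_def by (intro rec_intros) auto
  from recursive_pred_bounded_all[OF D_step this]
  have D_rec: "recursive_pred {} 2 (D b)" for b
    unfolding D_def by simp
  \<comment> \<open>The initial segment of \<open>X\<close> is itself a candidate.\<close>
  have D_correct: "n \<in> X \<longleftrightarrow> b" if "D b [m, n]" for b m n
  proof -
    let ?\<tau> = "initial_segment X (lev m n)"
    define j where "j = Suc (string_code ?\<tau>) - 2 ^ lev m n"
    have j: "2 ^ lev m n + j = Suc (string_code ?\<tau>)" "j < 2 ^ lev m n"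
      using string_code_lower[of ?\<tau>] string_code_upper[of ?\<tau>] by (auto simp: j_def)
    have bits: "odd ((2 ^ lev m n + j) div 2 ^ i) \<longleftrightarrow> i \<in> X" if "i < lev m n" for i
      unfolding j using string_code_bit[of i ?\<tau>] that by simp
    have "?\<tau> \<in> \<Lambda>" using X by (simp add: paths_def)
    then have "cand j m n"
      unfolding cand_def using bits v j by (auto simp: lev_def)
    then show ?thesis using that j(2) bits[of n] by (auto simp: D_def lev_def)
  qed
  have "\<exists>m. D True [m, n] \<or> D False [m, n]" for n
  proof -
    obtain L where L: "\<And>\<tau>. \<tau> \<in> \<Lambda> \<Longrightarrow> L \<le> length \<tau> \<Longrightarrow> \<forall>i<k. \<tau> ! i \<longleftrightarrow> i \<in> X \<Longrightarrow> \<tau> ! n \<longleftrightarrow> n \<in> X"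
      using isolated_path_bit_decided[OF closed isolated] by blast
    have "odd ((2 ^ lev L n + j) div 2 ^ n) \<longleftrightarrow> n \<in> X" if j: "j < 2 ^ lev L n" "cand j L n" for j
    proof -
      obtain \<tau> where \<tau>: "\<tau> \<in> \<Lambda>" "2 ^ lev L n + j - 1 = string_code \<tau>"
        using j(2) unfolding cand_def by blast
      have pos: "0 < (2 :: nat) ^ lev L n" by simp
      have code: "Suc (string_code \<tau>) = 2 ^ lev L n + j"
        using \<tau>(2) pos by linarith
      have len: "length \<tau> = lev L n" using code j(1) by (rule string_code_length)
      have bits: "odd ((2 ^ lev L n + j) div 2 ^ i) \<longleftrightarrow> \<tau> ! i" if "i < lev L n" for i
        using string_code_bit[of i \<tau>] that len code by simp
      have "\<tau> ! i \<longleftrightarrow> i \<in> X" if "i < k" for i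
        using j(2) bits[of i] v[of i] that by (auto simp: cand_def lev_def)
      then show ?thesis using L[OF \<tau>(1)] len bits[of n] by (auto simp: lev_def)
    qed
    then have "D (n \<in> X) [L, n]" by (simp add: D_def)
    then show ?thesis by (cases "n \<in> X") auto
  qed
  then have "X \<le>\<^sub>T {}"
    by (intro turing_le_if_both_enumerable[OF D_rec D_rec, of True X False])
      (use D_correct in blast)+
  then show ?thesis by (simp add: computable_def)
qed

section \<open>Diagonalization\<close>

text \<open>The set of paths through any set of strings is closed, so it is uncountable if it is nonempty
  and has no isolated points: no sequence \<open>E\<close> exhausts it.\<close>

lemma diagonal_path:
  assumes ne: "Y0 \<in> paths \<Lambda>"
    and perfect: "\<And>X k. X \<in> paths \<Lambda> \<Longrightarrow> \<exists>Y\<in>paths \<Lambda>. Y \<noteq> X \<and> (\<forall>i<k. i \<in> Y \<longleftrightarrow> i \<in> X)"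
  shows "\<exists>Z\<in>paths \<Lambda>. \<forall>n :: nat. Z \<noteq> E n"
proof -
  \<comment> \<open>A pair \<open>(Y, l)\<close> stands for the extendible string \<open>initial_segment Y l\<close>.\<close>
  define nxt where "nxt n s s' \<longleftrightarrow> snd s < snd s' \<and> (\<forall>i<snd s. i \<in> fst s' \<longleftrightarrow> i \<in> fst s) \<and>
    (\<exists>i<snd s'. \<not> (i \<in> fst s' \<longleftrightarrow> i \<in> E n))" for n and s s' :: "nat set \<times> nat"
  have "\<exists>s. \<forall>n. fst (s n) \<in> paths \<Lambda> \<and> nxt n (s n) (s (Suc n))"
  proof (rule dependent_nat_choice)
    show "\<exists>s. fst s \<in> paths \<Lambda>" using ne by auto
    fix s :: "nat set \<times> nat" and n assume s: "fst s \<in> paths \<Lambda>"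
    obtain Y where Y: "Y \<in> paths \<Lambda>" "Y \<noteq> E n" "\<forall>i<snd s. i \<in> Y \<longleftrightarrow> i \<in> fst s"
    proof (cases "fst s = E n")
      case True
      with perfect[OF s, of "snd s"] that show ?thesis by auto
    next
      case False
      with s that show ?thesis by blast
    qed
    then obtain i where "\<not> (i \<in> Y \<longleftrightarrow> i \<in> E n)" by blast
    then have "nxt n s (Y, Suc (snd s + i))"
      using Y by (auto simp: nxt_def intro!: exI[of _ i])
    then show "\<exists>s'. fst s' \<in> paths \<Lambda> \<and> nxt n s s'" using Y(1) by (intro exI) auto
  qed
  then obtain s where s: "\<And>n. fst (s n) \<in> paths \<Lambda>" "\<And>n. nxt n (s n) (s (Suc n))" by blast
  \<comment> \<open>The strings grow and get arbitrarily long; \<open>Z\<close> is their limit.\<close>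
  have len: "n \<le> snd (s n)" for n
  proof (induction n)
    case (Suc n)
    then show ?case using s(2)[of n] by (auto simp: nxt_def)
  qed simp
  have stable: "snd (s n) \<le> snd (s (n + d)) \<and> (\<forall>i<snd (s n). i \<in> fst (s (n + d)) \<longleftrightarrow> i \<in> fst (s n))"
    for n d
  proof (induction d)
    case (Suc d)
    then show ?case using s(2)[of "n + d"] by (auto simp: nxt_def)
  qed simp
  define Z where "Z = {i. i \<in> fst (s (Suc i))}"
  have Z: "i \<in> Z \<longleftrightarrow> i \<in> fst (s n)" if "i < snd (s n)" for i n
  proof (cases "n \<le> Suc i")
    case True
    then show ?thesis using stable[of n "Suc i - n"] that by (auto simp: Z_def)
  next
    case False
    then show ?thesis using stable[of "Suc i" "n - Suc i"] len[of "Suc i"] by (auto simp: Z_def)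
  qed
  have "initial_segment Z n = initial_segment (fst (s n)) n" for n
    using Z[of _ n] len[of n] by (auto simp: initial_segment_def)
  then have "Z \<in> paths \<Lambda>" using s(1) by (auto simp: paths_def)
  moreover have "Z \<noteq> E n" for n
    using s(2)[of n] Z[of _ "Suc n"] by (auto simp: nxt_def)
  ultimately show ?thesis by blast
qed

instance prog :: countable
  by countable_datatype

lemma turing_below_enumeration: "\<exists>E :: nat \<Rightarrow> nat set. \<forall>X. X \<le>\<^sub>T B \<longrightarrow> (\<exists>n. X = E n)"
proof (rule exI[of _ "\<lambda>n. {x. computes B (from_nat n) [x] 1}"], intro allI impI)
  fix X assume "X \<le>\<^sub>T B"
  then obtain p where p: "\<And>x. computes B p [x] (if x \<in> X then 1 else 0)"
    by (auto simp: turing_le_def)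
  have "x \<in> X \<longleftrightarrow> computes B p [x] 1" for x
    using p[of x] computes_deterministic[OF p[of x], of 1] by (cases "x \<in> X") auto
  then have "X = {x. computes B p [x] 1}" by blast
  then show "\<exists>n. X = {x. computes B (from_nat n) [x] 1}"
    by (intro exI[of _ "to_nat p"]) simp
qed

theorem theorem2:
  fixes P :: "nat set set" and A :: "nat \<Rightarrow> nat set"
  assumes "special_Pi01_class P"
    and "\<And>i. A i \<in> P"
  shows "\<exists>X\<in>P. \<not> X \<le>\<^sub>T infinite_join A"
proof -
  obtain \<Lambda> where \<Lambda>: "computable_strings \<Lambda>" "downward_closed \<Lambda>" "P = paths \<Lambda>"
    and special: "\<And>X. X \<in> P \<Longrightarrow> \<not> computable X"
    using assms(1) by (auto simp: special_Pi01_class_def Pi01_class_def)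
  have "\<exists>Y\<in>paths \<Lambda>. Y \<noteq> X \<and> (\<forall>i<k. i \<in> Y \<longleftrightarrow> i \<in> X)" if "X \<in> paths \<Lambda>" for X k
    using isolated_path_computable[OF \<Lambda>(1,2) that, of k] special that \<Lambda>(3) by blast
  moreover obtain E :: "nat \<Rightarrow> nat set" where E: "\<And>X. X \<le>\<^sub>T infinite_join A \<Longrightarrow> \<exists>n. X = E n"
    using turing_below_enumeration by blast
  moreover have "A 0 \<in> paths \<Lambda>" using assms(2) \<Lambda>(3) by simp
  ultimately obtain Z where "Z \<in> paths \<Lambda>" "\<forall>n. Z \<noteq> E n"
    using diagonal_path[of "A 0" \<Lambda> E] by blast
  then show ?thesis using E \<Lambda>(3) by blast
qed

end
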